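(* Let $\mathcal{P}$ be a finite or infinite set of primes and let $f$ be any dimension function such that $$\limsup_{\delta\to0}\frac{\log f(\delta)}{\log\delta}<\liminf_{\beta\to0}\frac{\log N_{\mathcal{C}}(\beta)}{|\log\beta|}.$$ Then the $f$-dimensional Hausdorff measure $\mathcal{H}^f$ of any cylinder absolute winning subset of $X_{\mathcal{P}}$ is greater than zero.
   Context: Setting. $\mathcal{P}=\{p_1<p_2<\cdots\}$ is a set of primes. $X_{\mathcal{P}}=\mathbb{R}\times\prod'_{p\in\mathcal{P}}\mathbb{Q}_p$ is the restricted product: elements are $\mathbf{x}=(x_0,x_1,x_2,\dots)$ with $x_0\in\mathbb{R}$, $x_i\in\mathbb{Q}_{p_i}$, and $x_i\in\mathbb{Z}_{p_i}$ for all but finitely many $i$. The metric is $d(\mathbf{x},\mathbf{z})=\max\{|x_0-z_0|,\ \sup_{i\ge1}p_i^{-1}|x_i-z_i|_{p_i}\}$, with $|\cdot|_p$ the usual $p$-adic absolute value ($|p|_p=1/p$). $\overline{B}(\mathbf{x},r)=\{\mathbf{z}: d(\mathbf{x},\mathbf{z})\le r\}$ is the closed ball of radius $r>0$. Cylinders. For $\mathbf{x}\in X_{\mathcal{P}}$, $\varepsilon>0$, the open cylinder $C(\mathbf{x},\varepsilon,i)$ with constraining coordinate $i$ is $\{\mathbf{z}\in X_{\mathcal{P}}:|z_0-x_0|<\varepsilon\}$ if $i=0$ and $\{\mathbf{z}\in X_{\mathcal{P}}:|z_i-x_i|_{p_i}<p_i\varepsilon\}$ if $i>0$. Its radius is $\varepsilon$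 if $i=0$, and the infimum of all $\varepsilon'>0$ with $C(\mathbf{x},\varepsilon',i)=C(\mathbf{x},\varepsilon,i)$ if $i>0$. Game. Let $F\subset X_{\mathcal{P}}$ and $0<\beta<1$. In the cylinder $\beta$-absolute game Bob first chooses a closed ball $B_0$. For $j\ge1$, given $B_{j-1}$, Alice chooses an open cylinder $C_j$ of radius at most $\beta\cdot\mathrm{radius}(B_{j-1})$, and then Bob chooses a closed ball $B_j\subset B_{j-1}\setminus C_j$ with $\mathrm{radius}(B_j)\ge\beta\cdot\mathrm{radius}(B_{j-1})$. If at some finite stage Bob has no legal choice, Bob wins; otherwise Alice wins iff $\bigcap_j B_j\cap F\ne\emptyset$. $F$ is cylinder $\beta$-absolute winning if Alice has a winning strategy, and cylinder absolute winning (CAW) if there is $0<\beta_1\le1/3$ such that it is cylinder $\beta$-absolute winning for all $\beta\in(0,\beta_1)$. The number $N_{\mathcal{C}}(\beta)$. For $0<\beta<1$, $N_{\mathcal{C}}(\beta)$ is the minimum, over all closed balls $\overline{B}(\mathbf{x},r)$ and all open cylinders $C(\mathbf{y},\beta r,i)$ with $i=0$ or $p_i<1/\beta$, of the maximum number of pairwise disjoint balls of radius $\beta r$ contained in $\overline{B}(\mathbf{x},r)$ which do not intersect $C(\mathbf{y},\beta r,i)$ and which are at distance at least $\beta r$ from each other. A dimension function is a function $f:\mathbb{R}_{\ge0}\to\mathbb{R}_{\ge0}$ which is increasing on some $[0,a_f)$, continuous on $(0,a_f)$, right continuous at $0$, and with $f(r)=0$ iff $r=0$. $\mathcal{H}^f$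 is the Hausdorff measure with gauge $f$: $\mathcal{H}^f(E)=\lim_{\delta\to0}\inf\{\sum_n f(|U_n|): (U_n)\text{ a countable cover of }E,\ |U_n|\le\delta\}$, $|\cdot|$ being the diameter. *)

theory Defs
  imports
    "HOL-Analysis.Analysis"
    "HOL-Computational_Algebra.Primes"
    "HOL-Library.Extended_Nat"
    "HOL-Library.Extended_Nonnegative_Real"
begin

section \<open>The field of \<open>p\<close>-adic numbers as a metric completion of the rationals\<close>

definition padic_abs :: "nat \<Rightarrow> rat \<Rightarrow> real" where
  "padic_abs p q =
     (if q = 0 then 0
      else real p powi (int (multiplicity (int p) (snd (quotient_of q)))
                      - int (multiplicity (int p) (fst (quotient_of q)))))"

definition padic_Cauchy :: "nat \<Rightarrow> (nat \<Rightarrow> rat) \<Rightarrow> bool" where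
  "padic_Cauchy p X \<longleftrightarrow> (\<forall>e>0. \<exists>N. \<forall>m\<ge>N. \<forall>n\<ge>N. padic_abs p (X m - X n) < e)"

definition padic_rel :: "nat \<Rightarrow> ((nat \<Rightarrow> rat) \<times> (nat \<Rightarrow> rat)) set" where
  "padic_rel p = {(X, Y). padic_Cauchy p X \<and> padic_Cauchy p Y \<and>
                          (\<lambda>n. padic_abs p (X n - Y n)) \<longlonglongrightarrow> 0}"

text \<open>The prime is a value and not a type, so \<open>\<rat>\<^sub>p\<close> is a carrier set: the
  equivalence classes of \<open>p\<close>-adic Cauchy sequences modulo null sequences. Of its field structure
  only subtraction and the absolute value are needed.\<close>

type_synonym padic = "(nat \<Rightarrow> rat) set"

definition Qp :: "nat \<Rightarrow> padic set" where
  "Qp p = {X. padic_Cauchy p X} // padic_rel p"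

definition padic_minus :: "nat \<Rightarrow> padic \<Rightarrow> padic \<Rightarrow> padic" where
  "padic_minus p x y = (\<Union>X\<in>x. \<Union>Y\<in>y. padic_rel p `` {\<lambda>n. X n - Y n})"

definition padic_norm :: "nat \<Rightarrow> padic \<Rightarrow> real" where
  "padic_norm p x = (THE r. \<forall>X\<in>x. (\<lambda>n. padic_abs p (X n)) \<longlonglongrightarrow> r)"

definition Zp :: "nat \<Rightarrow> padic set" where
  "Zp p = {x \<in> Qp p. padic_norm p x \<le> 1}"


section \<open>The restricted product \<open>X\<^sub>P\<close>\<close>

text \<open>The non-archimedean coordinates are indexed by the primes \<open>p \<in> P\<close> themselves, and the index
  \<open>0\<close> stands for the real coordinate. The component function is extensional (\<open>undefined\<close> outside
  \<open>P\<close>), so that points of \<open>X\<^sub>P\<close> are determined by their coordinates.\<close>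

type_synonym xpoint = "real \<times> (nat \<Rightarrow> padic)"

definition XP :: "nat set \<Rightarrow> xpoint set" where
  "XP P = {x. snd x \<in> (\<Pi>\<^sub>E p\<in>P. Qp p) \<and> finite {p \<in> P. snd x p \<notin> Zp p}}"

text \<open>The maximum of the real distance and the supremum of the weighted \<open>p\<close>-adic distances, written
  as one supremum so that it is also meaningful for \<open>P = {}\<close>.\<close>

definition dX :: "nat set \<Rightarrow> xpoint \<Rightarrow> xpoint \<Rightarrow> real" where
  "dX P x z = Sup (insert \<bar>fst x - fst z\<bar>
                ((\<lambda>p. padic_norm p (padic_minus p (snd x p) (snd z p)) / real p) ` P))"

definition ballX :: "nat set \<Rightarrow> xpoint \<Rightarrow> real \<Rightarrow> xpoint set" where
  "ballX P x r = {z \<in> XP P. dX P x z \<le> r}"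

definition cyl :: "nat set \<Rightarrow> xpoint \<Rightarrow> real \<Rightarrow> nat \<Rightarrow> xpoint set" where
  "cyl P x \<epsilon> i =
     (if i = 0 then {z \<in> XP P. \<bar>fst z - fst x\<bar> < \<epsilon>}
      else {z \<in> XP P. padic_norm i (padic_minus i (snd z i) (snd x i)) < real i * \<epsilon>})"

definition cyl_radius :: "nat set \<Rightarrow> xpoint \<Rightarrow> real \<Rightarrow> nat \<Rightarrow> real" where
  "cyl_radius P x \<epsilon> i =
     (if i = 0 then \<epsilon> else Inf {\<epsilon>'. \<epsilon>' > 0 \<and> cyl P x \<epsilon>' i = cyl P x \<epsilon> i})"


section \<open>The cylinder absolute game\<close>

type_synonym xball = "xpoint \<times> real"
type_synonym xcyl = "xpoint \<times> real \<times> nat"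

definition alice_legal :: "nat set \<Rightarrow> real \<Rightarrow> xball \<Rightarrow> xcyl \<Rightarrow> bool" where
  "alice_legal P \<beta> = (\<lambda>(x, r) (y, \<epsilon>, i).
     y \<in> XP P \<and> \<epsilon> > 0 \<and> i \<in> insert 0 P \<and> cyl_radius P y \<epsilon> i \<le> \<beta> * r)"

definition bob_legal :: "nat set \<Rightarrow> real \<Rightarrow> xball \<Rightarrow> xcyl \<Rightarrow> xball \<Rightarrow> bool" where
  "bob_legal P \<beta> = (\<lambda>(x, r) (y, \<epsilon>, i) (x', r').
     x' \<in> XP P \<and> r' > 0 \<and> ballX P x' r' \<subseteq> ballX P x r - cyl P y \<epsilon> i \<and> r' \<ge> \<beta> * r)"

text \<open>A strategy \<open>\<sigma>\<close> for Alice maps the list \<open>[B\<^sub>0, \<dots>, B\<^sub>n]\<close> of Bob's moves so far to the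
  cylinder \<open>C\<close> with index \<open>n + 1\<close>; her own earlier moves are determined by \<open>\<sigma>\<close> and that list.
  The predicate says that Bob's moves \<open>B 0, \<dots>, B n\<close> are legal against \<open>\<sigma>\<close>.\<close>

definition bob_legal_upto ::
    "nat set \<Rightarrow> real \<Rightarrow> (xball list \<Rightarrow> xcyl) \<Rightarrow> (nat \<Rightarrow> xball) \<Rightarrow> nat \<Rightarrow> bool" where
  "bob_legal_upto P \<beta> \<sigma> B n \<longleftrightarrow>
     fst (B 0) \<in> XP P \<and> snd (B 0) > 0 \<and>
     (\<forall>j<n. bob_legal P \<beta> (B j) (\<sigma> (map B [0..<Suc j])) (B (Suc j)))"

text \<open>The first conjunct demands that Alice's moves are legal and that Bob never runs out of
  legal moves, since Bob wins in that case.\<close>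

definition alice_winning_strategy ::
    "nat set \<Rightarrow> real \<Rightarrow> xpoint set \<Rightarrow> (xball list \<Rightarrow> xcyl) \<Rightarrow> bool" where
  "alice_winning_strategy P \<beta> F \<sigma> \<longleftrightarrow>
     (\<forall>B.
        (\<forall>n. bob_legal_upto P \<beta> \<sigma> B n \<longrightarrow>
              alice_legal P \<beta> (B n) (\<sigma> (map B [0..<Suc n])) \<and>
              (\<exists>b. bob_legal P \<beta> (B n) (\<sigma> (map B [0..<Suc n])) b)) \<and>
        ((\<forall>n. bob_legal_upto P \<beta> \<sigma> B n) \<longrightarrow>
              (\<Inter>n. ballX P (fst (B n)) (snd (B n))) \<inter> F \<noteq> {}))"

definition cylinder_absolute_winning_for :: "nat set \<Rightarrow> real \<Rightarrow> xpoint set \<Rightarrow> bool" where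
  "cylinder_absolute_winning_for P \<beta> F \<longleftrightarrow>
     F \<subseteq> XP P \<and> 0 < \<beta> \<and> \<beta> < 1 \<and> (\<exists>\<sigma>. alice_winning_strategy P \<beta> F \<sigma>)"

definition CAW :: "nat set \<Rightarrow> xpoint set \<Rightarrow> bool" where
  "CAW P F \<longleftrightarrow>
     (\<exists>\<beta>1. 0 < \<beta>1 \<and> \<beta>1 \<le> 1/3 \<and> (\<forall>\<beta>\<in>{0<..<\<beta>1}. cylinder_absolute_winning_for P \<beta> F))"


section \<open>The counting function\<close>

definition distX_set :: "nat set \<Rightarrow> xpoint set \<Rightarrow> xpoint set \<Rightarrow> real" where
  "distX_set P A B = (INF (a, b)\<in>A \<times> B. dX P a b)"

definition admissible_family ::
    "nat set \<Rightarrow> real \<Rightarrow> xpoint \<Rightarrow> real \<Rightarrow> xpoint \<Rightarrow> nat \<Rightarrow> xpoint set set \<Rightarrow> bool" where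
  "admissible_family P \<beta> x r y i \<B> \<longleftrightarrow>
     finite \<B> \<and>
     (\<forall>B\<in>\<B>. (\<exists>z\<in>XP P. B = ballX P z (\<beta> * r)) \<and> B \<subseteq> ballX P x r \<and> B \<inter> cyl P y (\<beta> * r) i = {}) \<and>
     (\<forall>A\<in>\<B>. \<forall>B\<in>\<B>. A \<noteq> B \<longrightarrow> A \<inter> B = {} \<and> distX_set P A B \<ge> \<beta> * r)"

text \<open>For infinite \<open>P\<close> and some large \<open>r\<close> there is no maximum, because infinitely many coordinates
  split; it is then \<open>\<infinity>\<close>. Otherwise the supremum below is a maximum. An infimum of a
  nonempty set of extended naturals is always a minimum.\<close>

definition max_admissible :: "nat set \<Rightarrow> real \<Rightarrow> xpoint \<Rightarrow> real \<Rightarrow> xpoint \<Rightarrow> nat \<Rightarrow> enat" where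
  "max_admissible P \<beta> x r y i = Sup {enat (card \<B>) |\<B>. admissible_family P \<beta> x r y i \<B>}"

definition NC :: "nat set \<Rightarrow> real \<Rightarrow> enat" where
  "NC P \<beta> = Inf {max_admissible P \<beta> x r y i |x r y i.
                   x \<in> XP P \<and> r > 0 \<and> y \<in> XP P \<and>
                   (i = 0 \<or> i \<in> P \<and> real i < 1 / \<beta>)}"

definition ln_enat :: "enat \<Rightarrow> ereal" where
  "ln_enat n = (case n of \<infinity> \<Rightarrow> \<infinity> | enat k \<Rightarrow> if k = 0 then -\<infinity> else ereal (ln (real k)))"


section \<open>Dimension functions and Hausdorff measure\<close>

text \<open>Only the values of \<open>f\<close> on the nonnegative reals are constrained.\<close>

definition dimension_function :: "(real \<Rightarrow> real) \<Rightarrow> bool" where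
  "dimension_function f \<longleftrightarrow>
     (\<forall>r\<ge>0. f r \<ge> 0) \<and> (\<forall>r\<ge>0. f r = 0 \<longleftrightarrow> r = 0) \<and>
     (\<exists>a>0. mono_on {0..<a} f \<and> continuous_on {0<..<a} f) \<and>
     continuous (at_right 0) f"

definition diamX :: "nat set \<Rightarrow> xpoint set \<Rightarrow> ennreal" where
  "diamX P U = (SUP (u, v)\<in>U \<times> U. ennreal (dX P u v))"

text \<open>Covers are indexed by \<open>nat\<close>; finite covers are included, as empty sets have
  diameter \<open>0\<close> and gauge functions vanish at \<open>0\<close>.\<close>

definition hausdorff_premeasure ::
    "nat set \<Rightarrow> (real \<Rightarrow> real) \<Rightarrow> real \<Rightarrow> xpoint set \<Rightarrow> ennreal" where
  "hausdorff_premeasure P f \<delta> E =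
     Inf {(\<Sum>n. ennreal (f (enn2real (diamX P (U n))))) |U :: nat \<Rightarrow> xpoint set.
            E \<subseteq> (\<Union>n. U n) \<and> (\<forall>n. U n \<subseteq> XP P \<and> diamX P (U n) \<le> ennreal \<delta>)}"

definition hausdorff_measure :: "nat set \<Rightarrow> (real \<Rightarrow> real) \<Rightarrow> xpoint set \<Rightarrow> ennreal" where
  "hausdorff_measure P f E = Lim (at_right 0) (\<lambda>\<delta>. hausdorff_premeasure P f \<delta> E)"


section \<open>Well-definedness\<close>

lemma padic_abs_divide:
  assumes "prime p" "a \<noteq> 0" "b \<noteq> 0"
  shows "padic_abs p (of_int a / of_int b) =
           real p powi (int (multiplicity (int p) b) - int (multiplicity (int p) a))"
proof -
  let ?q = "of_int a / of_int b :: rat"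
  obtain c d where cd: "quotient_of ?q = (c, d)" by fastforce
  have d: "d > 0" using quotient_of_denom_pos[OF cd] .
  have q: "?q = of_int c / of_int d" using quotient_of_div[OF cd] .
  have c: "c \<noteq> 0" using q assms d by auto
  have "of_int (a * d) = (of_int (c * b) :: rat)"
    using q assms d by (simp add: field_simps)
  then have eq: "a * d = c * b" by (simp only: of_int_eq_iff)
  have pe: "prime_elem (int p)" using assms by simp
  have "multiplicity (int p) a + multiplicity (int p) d
      = multiplicity (int p) c + multiplicity (int p) b"
    using arg_cong[OF eq, of "multiplicity (int p)"] pe assms c d
    by (simp add: prime_elem_multiplicity_mult_distrib)
  then have "int (multiplicity (int p) d) - int (multiplicity (int p) c)
      = int (multiplicity (int p) b) - int (multiplicity (int p) a)" by linarith
  then show ?thesis using assms cd by (simp add: padic_abs_def)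
qed

lemma padic_abs_0 [simp]: "padic_abs p 0 = 0"
  by (simp add: padic_abs_def)

lemma padic_abs_nonneg: "padic_abs p q \<ge> 0"
  by (simp add: padic_abs_def)

lemma padic_abs_eq_0_iff: "prime p \<Longrightarrow> padic_abs p q = 0 \<longleftrightarrow> q = 0"
  by (auto simp: padic_abs_def prime_gt_0_nat)

lemma rat_common_denom:
  fixes q r :: rat
  obtains a b c :: int where "q = of_int a / of_int c" "r = of_int b / of_int c" "c \<noteq> 0"
proof -
  obtain a1 d1 where q: "quotient_of q = (a1, d1)" by fastforce
  obtain a2 d2 where r: "quotient_of r = (a2, d2)" by fastforce
  show thesis
    by (rule that[of "a1 * d2" "d1 * d2" "a2 * d1"])
       (use quotient_of_div[OF q] quotient_of_div[OF r]
          quotient_of_denom_pos[OF q] quotient_of_denom_pos[OF r] in auto)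
qed

lemma padic_abs_minus [simp]: "padic_abs p (- q) = padic_abs p q"
proof -
  have "multiplicity (int p) (- a) = multiplicity (int p) a" for a
    by (simp add: multiplicity_def)
  then show ?thesis
    by (cases "quotient_of q") (simp add: padic_abs_def rat_uminus_code)
qed

lemma padic_abs_minus_commute: "padic_abs p (q - r) = padic_abs p (r - q)"
  using padic_abs_minus[of p "q - r"] by simp

lemma padic_abs_ultrametric:
  assumes p: "prime p"
  shows "padic_abs p (q + r) \<le> max (padic_abs p q) (padic_abs p r)"
proof (cases "q = 0 \<or> r = 0 \<or> q + r = 0")
  case True
  then show ?thesis using padic_abs_nonneg[of p q] padic_abs_nonneg[of p r] by auto
next
  case False
  obtain a b c where abc: "q = of_int a / of_int c" "r = of_int b / of_int c" "c \<noteq> (0::int)"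
    by (rule rat_common_denom)
  have s: "q + r = of_int (a + b) / of_int c" using abc by (simp add: add_divide_distrib)
  have nz: "a \<noteq> 0" "b \<noteq> 0" "a + b \<noteq> 0"
    using False abc s by auto
  let ?m = "multiplicity (int p)"
  have p1: "\<not> is_unit (int p)" using p by (metis not_prime_unit prime_nat_int_transfer)
  have "int p ^ min (?m a) (?m b) dvd a + b"
    by (intro dvd_add multiplicity_dvd') auto
  then have le: "min (?m a) (?m b) \<le> ?m (a + b)"
    by (rule multiplicity_geI[OF nz(3) p1])
  have pr: "real p \<ge> 1" using prime_ge_1_nat[OF p] by simp
  have "int (?m c) - int (?m (a + b)) \<le> int (?m c) - int (?m a) \<or>
        int (?m c) - int (?m (a + b)) \<le> int (?m c) - int (?m b)"
    using le by linarith
  then have "real p powi (int (?m c) - int (?m (a + b)))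
      \<le> max (real p powi (int (?m c) - int (?m a))) (real p powi (int (?m c) - int (?m b)))"
    using pr by (auto simp: le_max_iff_disj intro: power_int_increasing)
  then show ?thesis
    using padic_abs_divide[OF p nz(1) abc(3)] padic_abs_divide[OF p nz(2) abc(3)]
      padic_abs_divide[OF p nz(3) abc(3)]
    unfolding s unfolding abc(1,2) by simp
qed

lemma padic_abs_triangle: "prime p \<Longrightarrow> padic_abs p (q + r) \<le> padic_abs p q + padic_abs p r"
  using padic_abs_ultrametric[of p q r] padic_abs_nonneg[of p q] padic_abs_nonneg[of p r]
  by linarith

lemma padic_abs_reverse_triangle:
  assumes "prime p"
  shows "\<bar>padic_abs p q - padic_abs p r\<bar> \<le> padic_abs p (q - r)"
  using padic_abs_triangle[OF assms, of "q - r" r] padic_abs_triangle[OF assms, of "r - q" q]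
    padic_abs_minus_commute[of p q r] by simp

lemma padic_Cauchy_diff:
  assumes p: "prime p" and "padic_Cauchy p X" "padic_Cauchy p Y"
  shows "padic_Cauchy p (\<lambda>n. X n - Y n)"
  unfolding padic_Cauchy_def
proof (intro allI impI)
  fix e :: real assume "e > 0"
  then obtain M N where
    M: "\<And>m n. m \<ge> M \<Longrightarrow> n \<ge> M \<Longrightarrow> padic_abs p (X m - X n) < e" and
    N: "\<And>m n. m \<ge> N \<Longrightarrow> n \<ge> N \<Longrightarrow> padic_abs p (Y m - Y n) < e"
    using assms(2,3) unfolding padic_Cauchy_def by metis
  have "padic_abs p (X m - Y m - (X n - Y n)) < e" if "m \<ge> max M N" "n \<ge> max M N" for m n
  proof -
    have "X m - Y m - (X n - Y n) = (X m - X n) + (Y n - Y m)" by simp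
    then show ?thesis
      using padic_abs_ultrametric[OF p, of "X m - X n" "Y n - Y m"] M[of m n] N[of n m] that
      by (simp add: \<open>X m - Y m - (X n - Y n) = _\<close>)
  qed
  then show "\<exists>N. \<forall>m\<ge>N. \<forall>n\<ge>N. padic_abs p (X m - Y m - (X n - Y n)) < e" by blast
qed

lemma padic_rel_trans_lemma:
  assumes p: "prime p" and "(\<lambda>n. padic_abs p (X n)) \<longlonglongrightarrow> 0" "(\<lambda>n. padic_abs p (Y n)) \<longlonglongrightarrow> 0"
  shows "(\<lambda>n. padic_abs p (X n + Y n)) \<longlonglongrightarrow> 0"
proof (rule tendsto_sandwich[of "\<lambda>_. 0"])
  show "(\<lambda>n. padic_abs p (X n) + padic_abs p (Y n)) \<longlonglongrightarrow> 0"
    using tendsto_add[OF assms(2,3)] by simp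
qed (simp_all add: padic_abs_nonneg padic_abs_triangle[OF p])

lemma equiv_padic_rel:
  assumes p: "prime p"
  shows "equiv {X. padic_Cauchy p X} (padic_rel p)"
proof (rule equivI)
  show "padic_rel p \<subseteq> {X. padic_Cauchy p X} \<times> {X. padic_Cauchy p X}"
    by (auto simp: padic_rel_def)
  show "refl_on {X. padic_Cauchy p X} (padic_rel p)"
    by (auto simp: refl_on_def padic_rel_def)
  show "sym (padic_rel p)"
    by (auto simp: sym_def padic_rel_def padic_abs_minus_commute)
  show "trans (padic_rel p)"
  proof (rule transI)
    fix X Y Z assume "(X, Y) \<in> padic_rel p" "(Y, Z) \<in> padic_rel p"
    then show "(X, Z) \<in> padic_rel p"
      using padic_rel_trans_lemma[OF p, of "\<lambda>n. X n - Y n" "\<lambda>n. Y n - Z n"]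
      by (auto simp: padic_rel_def)
  qed
qed

lemma padic_Cauchy_abs_convergent:
  assumes p: "prime p" and X: "padic_Cauchy p X"
  shows "convergent (\<lambda>n. padic_abs p (X n))"
proof (rule Cauchy_convergent, rule metric_CauchyI)
  fix e :: real assume "e > 0"
  then obtain N where N: "\<And>m n. m \<ge> N \<Longrightarrow> n \<ge> N \<Longrightarrow> padic_abs p (X m - X n) < e"
    using X unfolding padic_Cauchy_def by metis
  then show "\<exists>N. \<forall>m\<ge>N. \<forall>n\<ge>N. dist (padic_abs p (X m)) (padic_abs p (X n)) < e"
    using padic_abs_reverse_triangle[OF p] by (metis dist_real_def le_less_trans)
qed

lemma Qp_rep:
  assumes p: "prime p" and "x \<in> Qp p"
  obtains X where "X \<in> x" "padic_Cauchy p X" "x = padic_rel p `` {X}"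
  using assms equiv_padic_rel[OF p] unfolding Qp_def
  by (metis equiv_class_self mem_Collect_eq quotientE)

lemma padic_norm_tendsto:
  assumes p: "prime p" and x: "x \<in> Qp p" and X: "X \<in> x"
  shows "(\<lambda>n. padic_abs p (X n)) \<longlonglongrightarrow> padic_norm p x"
proof -
  obtain Y where Y: "padic_Cauchy p Y" "x = padic_rel p `` {Y}"
    using Qp_rep[OF p x] .
  obtain r where r: "(\<lambda>n. padic_abs p (Y n)) \<longlonglongrightarrow> r"
    using padic_Cauchy_abs_convergent[OF p Y(1)] by (auto simp: convergent_def)
  have *: "(\<lambda>n. padic_abs p (Z n)) \<longlonglongrightarrow> r" if "Z \<in> x" for Z
  proof -
    have "(\<lambda>n. padic_abs p (Y n - Z n)) \<longlonglongrightarrow> 0"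
      using that Y by (auto simp: padic_rel_def)
    then have "(\<lambda>n. padic_abs p (Z n) - padic_abs p (Y n)) \<longlonglongrightarrow> 0"
      by (rule tendsto_rabs_zero_cancel[OF tendsto_sandwich[OF _ _ tendsto_const], rotated 2])
         (auto simp: padic_abs_reverse_triangle[OF p] padic_abs_minus_commute[of p "Y _"])
    from tendsto_add[OF this r] show ?thesis by simp
  qed
  have "padic_norm p x = r"
    unfolding padic_norm_def
    by (rule the_equality) (use * X LIMSEQ_unique in blast)+
  with *[OF X] show ?thesis by simp
qed

lemma padic_norm_nonneg: "prime p \<Longrightarrow> x \<in> Qp p \<Longrightarrow> padic_norm p x \<ge> 0"
  by (metis Qp_rep padic_norm_tendsto LIMSEQ_le_const padic_abs_nonneg)

lemma padic_minus_class:
  assumes p: "prime p" and "x \<in> Qp p" "y \<in> Qp p" "X \<in> x" "Y \<in> y"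
  shows "padic_minus p x y = padic_rel p `` {\<lambda>n. X n - Y n}"
proof -
  have "padic_rel p `` {\<lambda>n. X' n - Y' n} = padic_rel p `` {\<lambda>n. X n - Y n}"
    if "X' \<in> x" "Y' \<in> y" for X' Y'
  proof (rule equiv_class_eq[OF equiv_padic_rel[OF p]])
    have "(X', X) \<in> padic_rel p" "(Y, Y') \<in> padic_rel p"
      using assms that equiv_padic_rel[OF p] unfolding Qp_def
      by (metis quotient_eq_iff)+
    then show "(\<lambda>n. X' n - Y' n, \<lambda>n. X n - Y n) \<in> padic_rel p"
      using padic_rel_trans_lemma[OF p, of "\<lambda>n. X' n - X n" "\<lambda>n. Y n - Y' n"]
      by (auto simp: padic_rel_def padic_Cauchy_diff[OF p] algebra_simps)
  qed
  then show ?thesis using assms unfolding padic_minus_def by blast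
qed

lemma padic_minus_in_Qp:
  assumes "prime p" "x \<in> Qp p" "y \<in> Qp p"
  shows "padic_minus p x y \<in> Qp p"
proof -
  obtain X Y where "X \<in> x" "padic_Cauchy p X" "Y \<in> y" "padic_Cauchy p Y"
    using assms Qp_rep by metis
  then show ?thesis
    using padic_minus_class[OF assms] padic_Cauchy_diff[OF assms(1)]
    by (simp add: Qp_def quotientI)
qed

lemma padic_dist_tendsto:
  assumes p: "prime p" and "x \<in> Qp p" "y \<in> Qp p" "X \<in> x" "Y \<in> y"
  shows "(\<lambda>n. padic_abs p (X n - Y n)) \<longlonglongrightarrow> padic_norm p (padic_minus p x y)"
proof (rule padic_norm_tendsto[OF p padic_minus_in_Qp[OF assms(1-3)]])
  have "padic_Cauchy p X" "padic_Cauchy p Y"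
    using assms unfolding Qp_def quotient_def padic_rel_def by auto
  then show "(\<lambda>n. X n - Y n) \<in> padic_minus p x y"
    unfolding padic_minus_class[OF assms]
    using equiv_class_self[OF equiv_padic_rel[OF p]] padic_Cauchy_diff[OF p] by simp
qed

lemma padic_dist_commute:
  assumes p: "prime p" and "x \<in> Qp p" "y \<in> Qp p"
  shows "padic_norm p (padic_minus p x y) = padic_norm p (padic_minus p y x)"
proof -
  obtain X Y where "X \<in> x" "Y \<in> y" using assms Qp_rep by metis
  then show ?thesis
    using padic_dist_tendsto[OF assms] padic_dist_tendsto[OF p assms(3,2)]
      padic_abs_minus_commute[of p] by (metis (no_types, lifting) LIMSEQ_unique ext)
qed

lemma padic_dist_eq_0_iff:
  assumes p: "prime p" and "x \<in> Qp p" "y \<in> Qp p"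
  shows "padic_norm p (padic_minus p x y) = 0 \<longleftrightarrow> x = y"
proof -
  obtain X Y where XY: "X \<in> x" "Y \<in> y" "padic_Cauchy p X" "padic_Cauchy p Y"
    using assms Qp_rep by metis
  note lim = padic_dist_tendsto[OF assms XY(1,2)]
  have "x = y \<longleftrightarrow> (X, Y) \<in> padic_rel p"
    using quotient_eq_iff[OF equiv_padic_rel[OF p]] assms XY unfolding Qp_def by blast
  also have "\<dots> \<longleftrightarrow> (\<lambda>n. padic_abs p (X n - Y n)) \<longlonglongrightarrow> 0"
    using XY by (simp add: padic_rel_def)
  also have "\<dots> \<longleftrightarrow> padic_norm p (padic_minus p x y) = 0"
    using lim LIMSEQ_unique by metis
  finally show ?thesis by blast
qed

lemma padic_dist_ultrametric:
  assumes p: "prime p" and "x \<in> Qp p" "y \<in> Qp p" "z \<in> Qp p"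
  shows "padic_norm p (padic_minus p x z)
       \<le> max (padic_norm p (padic_minus p x y)) (padic_norm p (padic_minus p y z))"
proof -
  obtain X Y Z where XYZ: "X \<in> x" "Y \<in> y" "Z \<in> z"
    using assms Qp_rep by metis
  have "padic_abs p (X n - Z n) \<le> max (padic_abs p (X n - Y n)) (padic_abs p (Y n - Z n))" for n
    using padic_abs_ultrametric[OF p, of "X n - Y n" "Y n - Z n"] by simp
  then show ?thesis
    by (intro LIMSEQ_le[OF padic_dist_tendsto[OF assms(1,2,4) XYZ(1,3)]
          tendsto_max[OF padic_dist_tendsto[OF assms(1,2,3) XYZ(1,2)]
            padic_dist_tendsto[OF assms(1,3,4) XYZ(2,3)]]]) simp
qed

lemma padic_norm_minus_le_1:
  assumes p: "prime p" and x: "x \<in> Zp p" and z: "z \<in> Zp p"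
  shows "padic_norm p (padic_minus p x z) \<le> 1"
proof -
  have Q: "x \<in> Qp p" "z \<in> Qp p" using x z by (auto simp: Zp_def)
  obtain X Z where XZ: "X \<in> x" "Z \<in> z" using Q Qp_rep[OF p] by metis
  have "padic_abs p (X n - Z n) \<le> max (padic_abs p (X n)) (padic_abs p (Z n))" for n
    using padic_abs_ultrametric[OF p, of "X n" "- Z n"] by simp
  then have "padic_norm p (padic_minus p x z) \<le> max (padic_norm p x) (padic_norm p z)"
    by (intro LIMSEQ_le[OF padic_dist_tendsto[OF p Q XZ]
          tendsto_max[OF padic_norm_tendsto[OF p Q(1) XZ(1)] padic_norm_tendsto[OF p Q(2) XZ(2)]]])
       simp
  then show ?thesis using x z by (auto simp: Zp_def)
qed

lemma dX_bdd_above: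
  assumes P: "\<forall>p\<in>P. prime p" and "x \<in> XP P" "z \<in> XP P"
  shows "bdd_above (insert \<bar>fst x - fst z\<bar>
           ((\<lambda>p. padic_norm p (padic_minus p (snd x p) (snd z p)) / real p) ` P))"
proof -
  let ?g = "\<lambda>p. padic_norm p (padic_minus p (snd x p) (snd z p)) / real p"
  let ?S = "{p \<in> P. snd x p \<notin> Zp p} \<union> {p \<in> P. snd z p \<notin> Zp p}"
  have "finite ?S" using assms by (auto simp: XP_def)
  then have "bdd_above (?g ` ?S)" by (intro bdd_above_finite) auto
  moreover have "?g p \<le> 1" if "p \<in> P - ?S" for p
  proof -
    have "prime p" "snd x p \<in> Zp p" "snd z p \<in> Zp p" using that P by auto
    then show ?thesis
      using padic_norm_minus_le_1[of p "snd x p" "snd z p"] prime_ge_1_nat[of p]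
      by (simp add: divide_le_eq)
  qed
  then have "bdd_above (?g ` (P - ?S))" by (intro bdd_aboveI[of _ 1]) blast
  ultimately have "bdd_above (?g ` ?S \<union> ?g ` (P - ?S))" by (simp only: bdd_above_Un)
  then show ?thesis
    unfolding bdd_above_insert by (rule bdd_above_mono) auto
qed

lemma dX_le_iff:
  assumes "\<forall>p\<in>P. prime p" and "x \<in> XP P" "z \<in> XP P"
  shows "dX P x z \<le> r \<longleftrightarrow> \<bar>fst x - fst z\<bar> \<le> r \<and>
           (\<forall>p\<in>P. padic_norm p (padic_minus p (snd x p) (snd z p)) \<le> real p * r)"
proof -
  have "dX P x z \<le> r \<longleftrightarrow> \<bar>fst x - fst z\<bar> \<le> r \<and>
           (\<forall>p\<in>P. padic_norm p (padic_minus p (snd x p) (snd z p)) / real p \<le> r)"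
    unfolding dX_def by (subst cSup_le_iff[OF _ dX_bdd_above[OF assms]]) auto
  also have "\<dots> \<longleftrightarrow> \<bar>fst x - fst z\<bar> \<le> r \<and>
           (\<forall>p\<in>P. padic_norm p (padic_minus p (snd x p) (snd z p)) \<le> real p * r)"
    using assms(1) prime_gt_0_nat by (intro conj_cong ball_cong refl) (auto simp: divide_le_eq mult.commute)
  finally show ?thesis .
qed

text \<open>The locale demands symmetry and nonnegativity outside the carrier too, hence the truncation.\<close>

lemma Metric_space_XP:
  assumes P: "\<forall>p\<in>P. prime p"
  shows "Metric_space (XP P) (\<lambda>x y. if x \<in> XP P \<and> y \<in> XP P then dX P x y else 0)"
proof -
  have Q: "snd x p \<in> Qp p" if "x \<in> XP P" "p \<in> P" for x p
    using that by (auto simp: XP_def)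
  have nonneg: "0 \<le> dX P x y" if "x \<in> XP P" "y \<in> XP P" for x y
    using dX_le_iff[OF P that, of "dX P x y"] by linarith
  have commute: "dX P x y = dX P y x" if "x \<in> XP P" "y \<in> XP P" for x y
  proof -
    have "(\<lambda>p. padic_norm p (padic_minus p (snd x p) (snd y p)) / real p) ` P
        = (\<lambda>p. padic_norm p (padic_minus p (snd y p) (snd x p)) / real p) ` P"
      using that P Q padic_dist_commute by (intro image_cong) auto
    then show ?thesis unfolding dX_def by (simp add: abs_minus_commute)
  qed
  have zero: "dX P x y = 0 \<longleftrightarrow> x = y" if xy: "x \<in> XP P" "y \<in> XP P" for x y
  proof -
    have "dX P x y = 0 \<longleftrightarrow> dX P x y \<le> 0" using nonneg[OF xy] by linarith
    also have "\<dots> \<longleftrightarrow> fst x = fst y \<and> (\<forall>p\<in>P. snd x p = snd y p)"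
      unfolding dX_le_iff[OF P xy]
    proof (intro conj_cong ball_cong refl)
      show "\<bar>fst x - fst y\<bar> \<le> 0 \<longleftrightarrow> fst x = fst y" by simp
      fix p assume "p \<in> P"
      then have "prime p" "snd x p \<in> Qp p" "snd y p \<in> Qp p" using P Q xy by auto
      then show "padic_norm p (padic_minus p (snd x p) (snd y p)) \<le> real p * 0
          \<longleftrightarrow> snd x p = snd y p"
        using padic_dist_eq_0_iff padic_norm_nonneg padic_minus_in_Qp
        by (simp add: order.eq_iff[of _ 0] flip: padic_dist_eq_0_iff)
    qed
    also have "\<dots> \<longleftrightarrow> x = y"
      using xy by (auto simp: XP_def prod_eq_iff intro!: PiE_ext)
    finally show ?thesis .
  qed
  have tri: "dX P x z \<le> dX P x y + dX P y z"
    if xyz: "x \<in> XP P" "y \<in> XP P" "z \<in> XP P" for x y z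
  proof -
    have 1: "\<bar>fst x - fst y\<bar> \<le> dX P x y"
      "\<And>p. p \<in> P \<Longrightarrow> padic_norm p (padic_minus p (snd x p) (snd y p)) \<le> real p * dX P x y"
      using dX_le_iff[OF P xyz(1,2), of "dX P x y"] by auto
    have 2: "\<bar>fst y - fst z\<bar> \<le> dX P y z"
      "\<And>p. p \<in> P \<Longrightarrow> padic_norm p (padic_minus p (snd y p) (snd z p)) \<le> real p * dX P y z"
      using dX_le_iff[OF P xyz(2,3), of "dX P y z"] by auto
    show ?thesis
      unfolding dX_le_iff[OF P xyz(1,3)]
    proof (intro conjI ballI)
      show "\<bar>fst x - fst z\<bar> \<le> dX P x y + dX P y z" using 1(1) 2(1) by linarith
    next
      fix p assume p: "p \<in> P"
      let ?n = "\<lambda>u v. padic_norm p (padic_minus p (snd u p) (snd v p))"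
      have nn: "0 \<le> real p * dX P x y" "0 \<le> real p * dX P y z"
        using nonneg xyz by auto
      have "?n x z \<le> max (?n x y) (?n y z)"
        using P p Q xyz by (intro padic_dist_ultrametric) auto
      then show "?n x z \<le> real p * (dX P x y + dX P y z)"
        using nn 1(2)[OF p] 2(2)[OF p] unfolding distrib_left by linarith
    qed
  qed
  show ?thesis
    using nonneg commute zero tri by unfold_locales simp_all
qed

lemma hausdorff_measure_eq_SUP:
  "hausdorff_measure P f E = (SUP \<delta>\<in>{0<..}. hausdorff_premeasure P f \<delta> E)"
proof -
  let ?h = "\<lambda>\<delta>. hausdorff_premeasure P f \<delta> E"
  have mono: "?h \<delta>' \<le> ?h \<delta>" if "\<delta> \<le> \<delta>'" for \<delta> \<delta>'
  proof -
    have "ennreal \<delta> \<le> ennreal \<delta>'" using that by (rule ennreal_leI)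
    then have "diamX P A \<le> ennreal \<delta>'" if "diamX P A \<le> ennreal \<delta>" for A
      using that by (rule order_trans[rotated])
    then show ?thesis
      unfolding hausdorff_premeasure_def by (intro Inf_superset_mono Collect_mono) metis
  qed
  have "(?h \<longlongrightarrow> (SUP \<delta>\<in>{0<..}. ?h \<delta>)) (at_right 0)"
  proof (rule order_tendstoI)
    fix a assume "a < (SUP \<delta>\<in>{0<..}. ?h \<delta>)"
    then obtain \<delta>0 where "\<delta>0 > 0" "a < ?h \<delta>0" by (auto simp: less_SUP_iff)
    then show "\<forall>\<^sub>F \<delta> in at_right 0. a < ?h \<delta>"
      unfolding eventually_at_right_field using mono by (meson less_imp_le less_le_trans)
  next
    fix a assume a: "(SUP \<delta>\<in>{0<..}. ?h \<delta>) < a"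
    have "?h \<delta> < a" if "\<delta> > 0" for \<delta>
      using a that by (meson SUP_upper greaterThan_iff le_less_trans)
    then show "\<forall>\<^sub>F \<delta> in at_right 0. ?h \<delta> < a"
      unfolding eventually_at_right_field by (intro exI[of _ 1]) auto
  qed
  then show ?thesis
    unfolding hausdorff_measure_def by (intro tendsto_Lim) auto
qed

end

theory Submission
  imports Defs
begin

text \<open>A cover \<open>U n\<close> of a winning set is refuted by a single play, so no mass distribution is needed.
  Give \<open>U n\<close> a weight slightly above \<open>T f (diam (U n))\<close> with \<open>T = \<beta>\<^bsup>-s\<^esup>\<close>, where \<open>s\<close> lies strictly
  between the two exponents, and suppose that the total weight is below \<open>1\<close>. Bob keeps the invariant
  that the sets \<open>U n\<close> meeting his \<open>k\<close>-th ball, of radius \<open>\<beta>\<^bsup>k\<^esup>\<close>, have total weight below \<open>M\<^bsup>-k\<^esup>\<close>, where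
  \<open>M \<ge> T\<close>. He has \<open>M\<close> legal answers at mutual distance at least \<open>\<beta>\<^bsup>k+1\<^esup>\<close>; a set meeting two of them
  has weight at least \<open>M\<^bsup>-k\<^esup>\<close> and so does not occur, hence some answer receives at most the fraction
  \<open>1/M\<close> of the weight. The play converges to a point of the winning set that no \<open>U n\<close> contains.\<close>

section \<open>Points, balls and cylinders in coordinates\<close>

abbreviation padic_dist :: "nat \<Rightarrow> padic \<Rightarrow> padic \<Rightarrow> real" where
  "padic_dist p x y \<equiv> padic_norm p (padic_minus p x y)"

text \<open>A cylinder of index \<open>i\<close> constrains only the coordinate \<open>i\<close>, so
  balls are moved off it by overwriting that coordinate.\<close>

definition upd :: "nat \<Rightarrow> padic \<Rightarrow> xpoint \<Rightarrow> xpoint" where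
  "upd i b z = (fst z, (snd z)(i := b))"

lemma fst_upd [simp]: "fst (upd i b z) = fst z"
  and snd_upd [simp]: "snd (upd i b z) = (snd z)(i := b)"
  by (simp_all add: upd_def)

lemma XP_coord: "x \<in> XP P \<Longrightarrow> p \<in> P \<Longrightarrow> snd x p \<in> Qp p"
  by (auto simp: XP_def)

lemma upd_in_XP:
  assumes "z \<in> XP P" "i \<in> P" "b \<in> Qp i"
  shows "upd i b z \<in> XP P"
proof -
  have "finite (insert i {p \<in> P. snd z p \<notin> Zp p})"
    using assms(1) by (simp add: XP_def)
  then have "finite {p \<in> P. snd (upd i b z) p \<notin> Zp p}"
    by (rule rev_finite_subset) auto
  then show ?thesis
    using assms by (auto simp: XP_def PiE_iff extensional_def)
qed

text \<open>The origin lies in the restricted product, its p-adic coordinates being integers. Bob's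
  first ball needs some centre.\<close>

lemma XP_nonempty:
  assumes "\<forall>p\<in>P. prime p"
  shows "XP P \<noteq> {}"
proof -
  have "padic_rel p `` {\<lambda>_. 0} \<in> Zp p" if p: "prime p" for p
  proof -
    have C: "padic_Cauchy p (\<lambda>_. 0)"
      by (simp add: padic_Cauchy_def)
    then have Q: "padic_rel p `` {\<lambda>_. 0} \<in> Qp p"
      by (simp add: Qp_def quotientI)
    have "(\<lambda>_. 0) \<in> padic_rel p `` {\<lambda>_. 0}"
      using C by (simp add: padic_rel_def)
    from padic_norm_tendsto[OF p Q this] have "padic_norm p (padic_rel p `` {\<lambda>_. 0}) = 0"
      by (simp add: LIMSEQ_const_iff)
    with Q show ?thesis
      by (simp add: Zp_def)
  qed
  then have "(0, \<lambda>p\<in>P. padic_rel p `` {\<lambda>_. 0}) \<in> XP P"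
    using assms by (auto simp: XP_def Zp_def)
  then show ?thesis by blast
qed

lemma padic_dist_self: "prime p \<Longrightarrow> x \<in> Qp p \<Longrightarrow> padic_dist p x x = 0"
  by (simp add: padic_dist_eq_0_iff)

lemma dX_self: "\<forall>p\<in>P. prime p \<Longrightarrow> x \<in> XP P \<Longrightarrow> dX P x x = 0"
  using Metric_space.mdist_zero[OF Metric_space_XP[of P], of x] by auto

lemma ballX_iff:
  assumes "\<forall>p\<in>P. prime p" "x \<in> XP P"
  shows "z \<in> ballX P x r \<longleftrightarrow> z \<in> XP P \<and> \<bar>fst x - fst z\<bar> \<le> r \<and>
           (\<forall>p\<in>P. padic_dist p (snd x p) (snd z p) \<le> real p * r)"
  unfolding ballX_def mem_Collect_eq by (rule conj_cong[OF refl dX_le_iff[OF assms]])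

lemma center_in_ballX: "\<forall>p\<in>P. prime p \<Longrightarrow> x \<in> XP P \<Longrightarrow> r \<ge> 0 \<Longrightarrow> x \<in> ballX P x r"
  by (simp add: ballX_def dX_self)

text \<open>With the common value \<open>b\<close> the coordinate \<open>i\<close> contributes 0 to
  the supremum, and all other terms are kept.\<close>

lemma dX_upd_le:
  assumes P: "\<forall>p\<in>P. prime p" and "i \<in> P" "b \<in> Qp i" "x \<in> XP P" "y \<in> XP P"
  shows "dX P (upd i b x) (upd i b y) \<le> dX P x y"
proof -
  have 1: "\<bar>fst x - fst y\<bar> \<le> dX P x y"
    "\<And>p. p \<in> P \<Longrightarrow> padic_dist p (snd x p) (snd y p) \<le> real p * dX P x y"
    using dX_le_iff[OF P assms(4,5), of "dX P x y"] by auto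
  have "0 \<le> dX P x y" using 1(1) by linarith
  then show ?thesis
    using dX_le_iff[OF P upd_in_XP upd_in_XP] assms 1 by (auto simp: padic_dist_self)
qed

text \<open>The radius of a \<open>p\<close>-adic cylinder is an infimum that is not attained, so only the non-strict
  inequality holds in that case.\<close>

lemma alice_legal_cylD:
  assumes "alice_legal P \<beta> (x, r) (y, \<epsilon>, i)" and z: "z \<in> cyl P y \<epsilon> i"
  shows "if i = 0 then \<bar>fst z - fst y\<bar> < \<beta> * r
         else padic_dist i (snd z i) (snd y i) \<le> real i * (\<beta> * r)"
proof (cases "i = 0")
  case True
  then show ?thesis using assms by (auto simp: alice_legal_def cyl_def cyl_radius_def)
next
  case False
  let ?E = "{\<epsilon>'. \<epsilon>' > 0 \<and> cyl P y \<epsilon>' i = cyl P y \<epsilon> i}"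
  have E: "\<epsilon> \<in> ?E" and Inf: "Inf ?E \<le> \<beta> * r"
    using assms False by (auto simp: alice_legal_def cyl_radius_def)
  have "padic_dist i (snd z i) (snd y i) / real i \<le> \<beta> * r"
  proof (rule field_le_epsilon)
    fix e :: real assume "e > 0"
    with Inf have "Inf ?E < \<beta> * r + e" by linarith
    then obtain \<epsilon>' where \<epsilon>': "\<epsilon>' \<in> ?E" "\<epsilon>' < \<beta> * r + e"
      using cInf_lessD[of ?E] E by blast
    then have "z \<in> cyl P y \<epsilon>' i" using z by simp
    then have "padic_dist i (snd z i) (snd y i) < real i * \<epsilon>'"
      using False by (simp add: cyl_def)
    then have "padic_dist i (snd z i) (snd y i) / real i < \<epsilon>'"
      using False by (simp add: divide_less_eq mult.commute)
    with \<epsilon>' show "padic_dist i (snd z i) (snd y i) / real i \<le> \<beta> * r + e" by simp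
  qed
  then show ?thesis using False by (simp add: divide_le_eq mult.commute)
qed

section \<open>Separated families of balls\<close>

text \<open>Centres are recorded instead of balls so that a family can be moved pointwise. For
  \<open>\<rho>\<close> > 0 and a set \<open>P\<close> of primes, balls with distinct centres are
  disjoint, since a common point has distance 0 to itself; so \<open>card Z\<close> counts
  balls.\<close>

definition separated_centers :: "nat set \<Rightarrow> real \<Rightarrow> xpoint set \<Rightarrow> xpoint set \<Rightarrow> bool" where
  "separated_centers P \<rho> A Z \<longleftrightarrow>
     finite Z \<and> Z \<subseteq> XP P \<and> (\<forall>z\<in>Z. ballX P z \<rho> \<subseteq> A) \<and>
     (\<forall>z\<in>Z. \<forall>z'\<in>Z. z \<noteq> z' \<longrightarrow> (\<forall>u\<in>ballX P z \<rho>. \<forall>v\<in>ballX P z' \<rho>. \<rho> \<le> dX P u v))"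

lemma separated_centersD:
  assumes "separated_centers P \<rho> A Z"
  shows "finite Z" and "\<And>z. z \<in> Z \<Longrightarrow> z \<in> XP P" and "\<And>z. z \<in> Z \<Longrightarrow> ballX P z \<rho> \<subseteq> A"
    and "\<And>z z' u v. z \<in> Z \<Longrightarrow> z' \<in> Z \<Longrightarrow> z \<noteq> z' \<Longrightarrow>
           u \<in> ballX P z \<rho> \<Longrightarrow> v \<in> ballX P z' \<rho> \<Longrightarrow> \<rho> \<le> dX P u v"
  using assms by (auto simp: separated_centers_def simp del: split_paired_All)

lemma separated_centers_imageI:
  assumes "finite J" and "\<And>j. j \<in> J \<Longrightarrow> g j \<in> XP P" and "\<And>j. j \<in> J \<Longrightarrow> ballX P (g j) \<rho> \<subseteq> A"
    and "\<And>j k u v. j \<in> J \<Longrightarrow> k \<in> J \<Longrightarrow> g j \<noteq> g k \<Longrightarrow>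
           u \<in> ballX P (g j) \<rho> \<Longrightarrow> v \<in> ballX P (g k) \<rho> \<Longrightarrow> \<rho> \<le> dX P u v"
  shows "separated_centers P \<rho> A (g ` J)"
  unfolding separated_centers_def image_subset_iff ball_simps
proof (intro conjI ballI impI)
  show "finite (g ` J)" using assms(1) by (rule finite_imageI)
qed (fact assms(2) assms(3) assms(4))+

lemmas separated_centersI = separated_centers_imageI[where g = "\<lambda>z. z", unfolded image_ident]

lemma separated_centers_mono:
  assumes Z: "separated_centers P \<rho> A Z" and YZ: "Y \<subseteq> Z"
    and B: "\<And>z. z \<in> Y \<Longrightarrow> ballX P z \<rho> \<subseteq> B"
  shows "separated_centers P \<rho> B Y"
proof (rule separated_centersI)
  show "finite Y" using separated_centersD(1)[OF Z] YZ by (rule rev_finite_subset)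
  show "\<rho> \<le> dX P u v" if "z \<in> Y" "z' \<in> Y" "z \<noteq> z'" "u \<in> ballX P z \<rho>" "v \<in> ballX P z' \<rho>"
    for z z' u v
    using separated_centersD(4)[OF Z subsetD[OF YZ that(1)] subsetD[OF YZ that(2)] that(3-5)] .
  show "z \<in> XP P" if "z \<in> Y" for z
    using separated_centersD(2)[OF Z subsetD[OF YZ that]] .
qed (fact B)

text \<open>\<open>NC\<close> is an infimum in which the real cylinders compete for every
  \<open>\<beta>\<close>, so it bounds the count for index 0 from below.\<close>

lemma NC_separated_centers:
  assumes P: "\<forall>p\<in>P. prime p" and "\<beta> > 0" "r > 0" "x \<in> XP P" "y \<in> XP P"
    and N: "enat K \<le> NC P \<beta>"
  obtains Z where "separated_centers P (\<beta> * r) (ballX P x r - cyl P y (\<beta> * r) 0) Z" "card Z = K"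
proof -
  have "NC P \<beta> \<le> max_admissible P \<beta> x r y 0"
    unfolding NC_def using assms by (intro Inf_lower) blast
  then have le: "enat K \<le> max_admissible P \<beta> x r y 0" using N by simp
  \<comment> \<open>The supremum may be infinite, but some family reaches the finite
    \<open>K\<close>: otherwise \<open>K - 1\<close> would be an upper bound.\<close>
  have "\<exists>\<B>. admissible_family P \<beta> x r y 0 \<B> \<and> K \<le> card \<B>"
  proof (rule ccontr)
    assume "\<not> ?thesis"
    then have lt: "\<And>\<B>. admissible_family P \<beta> x r y 0 \<B> \<Longrightarrow> card \<B> < K" by (meson not_le)
    \<comment> \<open>The empty family forces \<open>K\<close> > 0, so that \<open>K - 1\<close> is
      a true predecessor.\<close>
    have "admissible_family P \<beta> x r y 0 {}" by (simp add: admissible_family_def)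
    from lt[OF this] have K: "K > 0" by simp
    have "max_admissible P \<beta> x r y 0 \<le> enat (K - 1)"
      unfolding max_admissible_def using lt by (intro Sup_least) fastforce
    with le have "enat K \<le> enat (K - 1)" by (rule order_trans)
    with K show False by simp
  qed
  then obtain \<B> where adm: "admissible_family P \<beta> x r y 0 \<B>" and "K \<le> card \<B>" by blast
  then obtain \<C> where \<C>: "\<C> \<subseteq> \<B>" "card \<C> = K" "finite \<C>"
    by (meson obtain_subset_with_card_n)
  have "\<forall>B\<in>\<C>. \<exists>z\<in>XP P. B = ballX P z (\<beta> * r)"
    using adm \<C>(1) by (auto simp: admissible_family_def)
  then obtain c where c: "\<And>B. B \<in> \<C> \<Longrightarrow> c B \<in> XP P \<and> B = ballX P (c B) (\<beta> * r)"
    by metis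
  have inj: "inj_on c \<C>" by (rule inj_onI) (metis c)
  have "\<beta> * r \<le> dX P u v" if "A \<in> \<C>" "B \<in> \<C>" "c A \<noteq> c B" "u \<in> A" "v \<in> B" for A B u v
  proof -
    have AB: "A \<subseteq> XP P" "B \<subseteq> XP P" using c that by (auto simp: ballX_def)
    have "\<beta> * r \<le> distX_set P A B"
    proof -
      have "A \<in> \<B>" "B \<in> \<B>" "A \<noteq> B" using \<C>(1) that by auto
      moreover have "\<forall>A\<in>\<B>. \<forall>B\<in>\<B>. A \<noteq> B \<longrightarrow> A \<inter> B = {} \<and> \<beta> * r \<le> distX_set P A B"
        using adm by (simp add: admissible_family_def)
      ultimately show ?thesis by simp
    qed
    also have "\<dots> \<le> dX P u v"
    proof -
      \<comment> \<open>A real infimum is a lower bound only for a set that is bounded below, here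
        by 0.\<close>
      have "0 \<le> dX P a b" if "a \<in> XP P" "b \<in> XP P" for a b
        using dX_le_iff[OF P that, of "dX P a b"] by linarith
      then have "bdd_below ((\<lambda>(a, b). dX P a b) ` (A \<times> B))"
        using AB by (intro bdd_belowI2[of _ 0]) (auto simp: subset_iff simp del: split_paired_All)
      then show ?thesis
        unfolding distX_set_def using cINF_lower[of "\<lambda>(a, b). dX P a b" "A \<times> B" "(u, v)"] that
        by simp
    qed
    finally show ?thesis .
  qed
  moreover have mem: "u \<in> B" if "B \<in> \<C>" "u \<in> ballX P (c B) (\<beta> * r)" for B u
    using c[OF that(1)] that(2) by simp
  ultimately have sep: "\<beta> * r \<le> dX P u v" if "A \<in> \<C>" "B \<in> \<C>" "c A \<noteq> c B"
      "u \<in> ballX P (c A) (\<beta> * r)" "v \<in> ballX P (c B) (\<beta> * r)" for A B u v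
    using that mem by presburger
  have sub: "ballX P (c B) (\<beta> * r) \<subseteq> ballX P x r - cyl P y (\<beta> * r) 0" if "B \<in> \<C>" for B
  proof -
    have "B \<subseteq> ballX P x r \<and> B \<inter> cyl P y (\<beta> * r) 0 = {}"
      using adm subsetD[OF \<C>(1) that] by (simp add: admissible_family_def)
    then show ?thesis using c[OF that] by auto
  qed
  show thesis
  proof (rule that[of "c ` \<C>"])
    show "separated_centers P (\<beta> * r) (ballX P x r - cyl P y (\<beta> * r) 0) (c ` \<C>)"
      using \<C>(3) _ sub sep
    proof (rule separated_centers_imageI)
      show "c B \<in> XP P" if "B \<in> \<C>" for B using c[OF that] by simp
    qed
    show "card (c ` \<C>) = K" using inj \<C>(2) by (simp add: card_image)
  qed
qed

text \<open>A \<open>p\<close>-adic cylinder is not among those over which \<open>NC\<close> minimises unless \<open>p < 1 / \<beta>\<close>. Instead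
  we start from a family avoiding a real cylinder. If at least half of it meets Alice's cylinder
  then these balls agree in the coordinate \<open>p\<close>, and all of them can be moved to the coordinate of
  some legal ball of Bob. This only costs a factor of \<open>2\<close>.\<close>

lemma bob_separated_choices:
  assumes P: "\<forall>p\<in>P. prime p" and "\<beta> > 0" "r > 0" and x: "x \<in> XP P"
    and N: "enat (2 * K) \<le> NC P \<beta>"
    and al: "alice_legal P \<beta> (x, r) (y, \<epsilon>, i)"
    and bl: "bob_legal P \<beta> (x, r) (y, \<epsilon>, i) (x', r')"
  obtains Z where "separated_centers P (\<beta> * r) (ballX P x r - cyl P y \<epsilon> i) Z" "card Z = K"
proof -
  let ?\<rho> = "\<beta> * r" and ?C = "cyl P y \<epsilon> i"
  have \<rho>: "?\<rho> > 0" using assms by simp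
  have y: "y \<in> XP P" and i: "i = 0 \<or> i \<in> P" using al by (auto simp: alice_legal_def)
  obtain Z where Z: "separated_centers P ?\<rho> (ballX P x r - cyl P y ?\<rho> 0) Z" "card Z = 2 * K"
    using NC_separated_centers[OF P assms(2,3) x y N] .
  show thesis
  proof (cases "i = 0")
    case True
    have "?C \<subseteq> cyl P y ?\<rho> 0"
    proof (rule subsetI)
      fix z assume z: "z \<in> ?C"
      then show "z \<in> cyl P y ?\<rho> 0"
        using alice_legal_cylD[OF al z] True by (simp add: cyl_def)
    qed
    then have sub: "ballX P z ?\<rho> \<subseteq> ballX P x r - ?C" if "z \<in> Z" for z
      using separated_centersD(3)[OF Z(1) that] by auto
    obtain Y where Y: "Y \<subseteq> Z" "card Y = K"
      using obtain_subset_with_card_n[of K Z] Z(2) by auto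
    have "separated_centers P ?\<rho> (ballX P x r - ?C) Y"
      using Z(1) Y(1) by (rule separated_centers_mono) (fact sub[OF subsetD[OF Y(1)]])
    then show thesis using that Y(2) by blast
  next
    case False
    then have iP: "i \<in> P" using i by simp
    then have pi: "prime i" using P by blast
    note coord = XP_coord[OF _ iP]
    have Zsub: "ballX P z ?\<rho> \<subseteq> ballX P x r" "z \<in> XP P" if "z \<in> Z" for z
      using separated_centersD(2,3)[OF Z(1) that] by auto
    note fin = separated_centersD(1)[OF Z(1)]
    define Z1 where "Z1 = {z \<in> Z. ballX P z ?\<rho> \<inter> ?C = {}}"
    define Z2 where "Z2 = {z \<in> Z. ballX P z ?\<rho> \<inter> ?C \<noteq> {}}"
    have "Z = Z1 \<union> Z2" "Z1 \<inter> Z2 = {}"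
      by (auto simp: Z1_def Z2_def)
    then have "card Z = card Z1 + card Z2"
      using fin card_Un_disjoint[of Z1 Z2] by auto
    then consider "K \<le> card Z1" | "K \<le> card Z2" using Z(2) by linarith
    then show thesis
    proof cases
      case 1
      then obtain Y where Y: "Y \<subseteq> Z1" "card Y = K"
        by (meson obtain_subset_with_card_n)
      have sub: "ballX P z ?\<rho> \<subseteq> ballX P x r - ?C" if "z \<in> Y" for z
      proof -
        have "z \<in> Z" "ballX P z ?\<rho> \<inter> ?C = {}"
          using subsetD[OF Y(1) that] by (simp_all add: Z1_def)
        then show ?thesis using Zsub(1)[of z] by auto
      qed
      have "separated_centers P ?\<rho> (ballX P x r - ?C) Y"
        using Z(1) _ sub by (rule separated_centers_mono) (use Y(1) in \<open>auto simp: Z1_def\<close>)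
      with Y(2) show thesis using that by blast
    next
      case 2
      then obtain Y where Y: "Y \<subseteq> Z2" "card Y = K" "finite Y"
        by (meson obtain_subset_with_card_n)
      have YZ: "Y \<subseteq> Z" using Y(1) by (auto simp: Z2_def)
      have x': "x' \<in> XP P" and r': "?\<rho> \<le> r'" and B': "ballX P x' r' \<subseteq> ballX P x r - ?C"
        using bl by (auto simp: bob_legal_def)
      \<comment> \<open>Bob's legal ball has radius at least \<open>?\<rho>\<close>, so every value
        of the coordinate \<open>i\<close> within \<open>real i * ?\<rho>\<close> of
        \<open>?b\<close> is compatible with the ball around \<open>x\<close> and lies off the
        cylinder.\<close>
      let ?b = "snd x' i"
      let ?g = "upd i ?b"
      have b: "?b \<in> Qp i" and yi: "snd y i \<in> Qp i" using coord x' y by auto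
      have gX: "?g z \<in> XP P" if "z \<in> Y" for z
        using upd_in_XP[OF _ iP b] YZ Zsub that by blast
      \<comment> \<open>The ultrametric inequality takes the maximum of the ball bound and the
        cylinder bound, so they do not add up.\<close>
      have near: "padic_dist i (snd z i) (snd y i) \<le> real i * ?\<rho>" if z: "z \<in> Y" for z
      proof -
        have zX: "z \<in> XP P" using YZ Zsub that by blast
        have "ballX P z ?\<rho> \<inter> ?C \<noteq> {}"
          using subsetD[OF Y(1) z] by (simp add: Z2_def)
        then obtain u where u: "u \<in> ballX P z ?\<rho>" "u \<in> ?C"
          by blast
        have uX: "u \<in> XP P" using u by (auto simp: ballX_def)
        have "padic_dist i (snd z i) (snd u i) \<le> real i * ?\<rho>"
          using u(1) ballX_iff[OF P zX] iP by blast
        moreover have "padic_dist i (snd u i) (snd y i) \<le> real i * ?\<rho>"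
          using alice_legal_cylD[OF al u(2)] False by simp
        ultimately show ?thesis
          using padic_dist_ultrametric[OF pi coord[OF zX] coord[OF uX] yi] by linarith
      qed
      \<comment> \<open>By \<open>near\<close>, resetting the coordinate \<open>i\<close> to that of
        \<open>y\<close> takes a moved ball back into the original one. The same value serves all
        \<open>z\<close>, as the contraction \<open>dX_upd_le\<close> requires in
        \<open>sep\<close>.\<close>
      have pull: "upd i (snd y i) u \<in> ballX P z ?\<rho>"
        if z: "z \<in> Y" and u: "u \<in> ballX P (?g z) ?\<rho>" for z u
      proof -
        have "upd i (snd y i) u \<in> XP P"
          using u upd_in_XP[OF _ iP yi] by (simp add: ballX_def)
        then show ?thesis
          using u near[OF z] unfolding ballX_iff[OF P gX[OF z]] ballX_iff[OF P Zsub(2)[OF subsetD[OF YZ z]]]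
          by auto
      qed
      have sub: "ballX P (?g z) ?\<rho> \<subseteq> ballX P x r - ?C" if z: "z \<in> Y" for z
      proof
        fix w assume w: "w \<in> ballX P (?g z) ?\<rho>"
        then have wX: "w \<in> XP P" by (simp add: ballX_def)
        note wi = coord[OF wX]
        have bw: "padic_dist i ?b (snd w i) \<le> real i * ?\<rho>"
          using w iP ballX_iff[OF P gX[OF z]] by auto
        have "real p * ?\<rho> \<le> real p * r'" for p
          using r' by (intro mult_left_mono) auto
        \<comment> \<open>The coordinate \<open>i\<close> of \<open>w\<close> is tested by grafting
          it onto \<open>x'\<close>, which stays in Bob's ball. The remaining coordinates of
          \<open>w\<close> are controlled by \<open>pull\<close>.\<close>
        then have "upd i (snd w i) x' \<in> ballX P x' r'"
          using bw r' \<rho> x' P upd_in_XP[OF x' iP wi] iP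
          by (auto simp: ballX_iff[OF P x'] padic_dist_self XP_coord intro: order_trans)
        then have *: "upd i (snd w i) x' \<in> ballX P x r - ?C" using B' by blast
        have "w \<notin> ?C" using * False wX upd_in_XP[OF x' iP wi] by (auto simp: cyl_def)
        moreover have "padic_dist i (snd x i) (snd w i) \<le> real i * r"
          using * iP by (auto simp: ballX_iff[OF P x] split: if_splits)
        moreover have "upd i (snd y i) w \<in> ballX P x r"
          using pull[OF z w] Zsub YZ z by blast
        ultimately show "w \<in> ballX P x r - ?C"
          using wX by (auto simp: ballX_iff[OF P x] split: if_splits)
      qed
      have sep: "?\<rho> \<le> dX P u v" if z: "z \<in> Y" "z' \<in> Y" "z \<noteq> z'"
        and u: "u \<in> ballX P (?g z) ?\<rho>" and v: "v \<in> ballX P (?g z') ?\<rho>" for z z' u v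
      proof -
        have "?\<rho> \<le> dX P (upd i (snd y i) u) (upd i (snd y i) v)"
          using separated_centersD(4)[OF Z(1) _ _ z(3) pull[OF z(1) u] pull[OF z(2) v]] z YZ
          by auto
        also have "\<dots> \<le> dX P u v"
          using u v by (intro dX_upd_le[OF P iP yi]) (auto simp: ballX_def)
        finally show ?thesis .
      qed
      have "inj_on ?g Y"
      proof (rule inj_onI, rule ccontr)
        fix z z' assume z: "z \<in> Y" "z' \<in> Y" "?g z = ?g z'" "z \<noteq> z'"
        have "?\<rho> \<le> dX P (?g z) (?g z)"
          using z gX \<rho> center_in_ballX[OF P] by (intro sep[OF z(1,2,4)]) auto
        then show False using dX_self[OF P gX[OF z(1)]] \<rho> by linarith
      qed
      then have "card (?g ` Y) = K" using Y(2) by (simp add: card_image)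
      moreover have "separated_centers P ?\<rho> (ballX P x r - ?C) (?g ` Y)"
        using Y(3) gX sub
      proof (rule separated_centers_imageI)
        show "?\<rho> \<le> dX P u v" if "z \<in> Y" "z' \<in> Y" "?g z \<noteq> ?g z'"
          "u \<in> ballX P (?g z) ?\<rho>" "v \<in> ballX P (?g z') ?\<rho>" for z z' u v
          using that(3) by (intro sep[OF that(1,2) _ that(4,5)]) auto
      qed
      ultimately show thesis using that by blast
    qed
  qed
qed

section \<open>Weights of cover sets along a play\<close>

definition hit_weight :: "nat set \<Rightarrow> (nat \<Rightarrow> xpoint set) \<Rightarrow> (nat \<Rightarrow> ennreal) \<Rightarrow> xball \<Rightarrow> ennreal" where
  "hit_weight P U a b = (\<Sum>n. if U n \<inter> ballX P (fst b) (snd b) = {} then 0 else a n)"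

lemma hit_weight_ge:
  assumes "w \<in> U n" "w \<in> ballX P (fst b) (snd b)"
  shows "a n \<le> hit_weight P U a b"
proof -
  let ?h = "\<lambda>n. if U n \<inter> ballX P (fst b) (snd b) = {} then 0 else a n"
  have "U n \<inter> ballX P (fst b) (snd b) \<noteq> {}" using assms by blast
  then have "a n = sum ?h {n}" by simp
  also have "\<dots> \<le> suminf ?h" by (rule sum_le_suminf) auto
  finally show ?thesis by (simp add: hit_weight_def)
qed

text \<open>By \<open>big\<close> and the separation, a set meeting two of the balls would alone
  violate the bound \<open>W\<close> on the parent ball. So each set is charged to at most one of
  them, and averaging over \<open>M\<close> balls applies.\<close>

lemma light_child:
  assumes Z: "separated_centers P \<rho> (ballX P x r - C) Z" and card: "card Z = M" and "M > 0"
    and W: "hit_weight P U a (x, r) < ennreal ((1 / real M) ^ k)"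
    and big: "\<And>n u v. u \<in> U n \<Longrightarrow> v \<in> U n \<Longrightarrow> \<rho> \<le> dX P u v \<Longrightarrow> ennreal ((1 / real M) ^ k) \<le> a n"
  obtains z where "z \<in> Z" "hit_weight P U a (z, \<rho>) < ennreal ((1 / real M) ^ Suc k)"
proof -
  let ?h = "\<lambda>z n. if U n \<inter> ballX P z \<rho> = {} then 0 else a n"
  have le: "(\<Sum>z\<in>Z. ?h z n) \<le> (if U n \<inter> ballX P x r = {} then 0 else a n)" for n
  proof (cases "\<exists>z\<in>Z. U n \<inter> ballX P z \<rho> \<noteq> {}")
    case False
    then have "(\<Sum>z\<in>Z. ?h z n) = 0" by (intro sum.neutral) simp
    then show ?thesis by simp
  next
    case True
    then obtain z u where z: "z \<in> Z" "u \<in> U n" "u \<in> ballX P z \<rho>" by blast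
    then have u: "u \<in> ballX P x r" using separated_centersD(3)[OF Z z(1)] by blast
    have "U n \<inter> ballX P z' \<rho> = {}" if z': "z' \<in> Z" "z' \<noteq> z" for z'
    proof (rule ccontr)
      assume "U n \<inter> ballX P z' \<rho> \<noteq> {}"
      then obtain v where v: "v \<in> U n" "v \<in> ballX P z' \<rho>" by blast
      have "ennreal ((1 / real M) ^ k) \<le> a n"
        by (rule big[OF z(2) v(1) separated_centersD(4)[OF Z z(1) z'(1) z'(2)[symmetric] z(3) v(2)]])
      also have "\<dots> \<le> hit_weight P U a (x, r)"
        using z(2) u by (intro hit_weight_ge) auto
      finally show False using W by simp
    qed
    then have "(\<Sum>z'\<in>Z. ?h z' n) = (\<Sum>z'\<in>{z}. ?h z' n)"
      using separated_centersD(1)[OF Z] z(1) by (intro sum.mono_neutral_right) auto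
    also have "\<dots> \<le> a n" by simp
    finally have "(\<Sum>z'\<in>Z. ?h z' n) \<le> a n" .
    moreover have "U n \<inter> ballX P x r \<noteq> {}" using z(2) u by blast
    ultimately show ?thesis by simp
  qed
  have "\<exists>z\<in>Z. hit_weight P U a (z, \<rho>) < ennreal ((1 / real M) ^ Suc k)"
  proof (rule ccontr)
    assume "\<not> ?thesis"
    then have ge: "ennreal ((1 / real M) ^ Suc k) \<le> hit_weight P U a (z, \<rho>)" if "z \<in> Z" for z
      using that by (meson not_le)
    have "ennreal ((1 / real M) ^ k) = of_nat M * ennreal ((1 / real M) ^ Suc k)"
      using \<open>M > 0\<close> by (simp add: ennreal_of_nat_eq_real_of_nat flip: ennreal_mult')
    also have "\<dots> = (\<Sum>z\<in>Z. ennreal ((1 / real M) ^ Suc k))"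
      using card by simp
    also have "\<dots> \<le> (\<Sum>z\<in>Z. hit_weight P U a (z, \<rho>))"
      using ge by (rule sum_mono)
    also have "\<dots> = (\<Sum>n. \<Sum>z\<in>Z. ?h z n)"
      unfolding hit_weight_def fst_conv snd_conv by (rule suminf_sum[symmetric]) simp
    also have "\<dots> \<le> hit_weight P U a (x, r)"
      unfolding hit_weight_def fst_conv snd_conv using le by (rule suminf_le) auto
    finally show False using W by simp
  qed
  then show thesis using that by blast
qed

text \<open>Positivity of the weights matters because the limit point may lie in a set of diameter
  0, and \<open>M\<close> \<ge> 2 makes the bounds tend to 0. The shift in \<open>big\<close> arises
  because the balls separated inside the ball of index \<open>k\<close> have radius
  \<open>\<beta> ^ Suc k\<close>.\<close>

lemma winning_set_not_covered:
  assumes P: "\<forall>p\<in>P. prime p" and \<sigma>: "alice_winning_strategy P \<beta> F \<sigma>" and \<beta>: "\<beta> > 0"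
    and N: "enat (2 * M) \<le> NC P \<beta>" and M: "M \<ge> 2"
    and cover: "F \<subseteq> (\<Union>n. U n)" and pos: "\<And>n. a n > 0" and sum: "(\<Sum>n. a n) < 1"
    and big: "\<And>n k u v. u \<in> U n \<Longrightarrow> v \<in> U n \<Longrightarrow> \<beta> ^ Suc k \<le> dX P u v \<Longrightarrow>
                ennreal ((1 / real M) ^ k) \<le> a n"
  shows False
proof -
  obtain x0 where x0: "x0 \<in> XP P" using XP_nonempty[OF P] by blast
  define good where "good k b \<longleftrightarrow> fst b \<in> XP P \<and> snd b = \<beta> ^ k \<and>
      hit_weight P U a b < ennreal ((1 / real M) ^ k)" for k and b :: xball
  \<comment> \<open>The recursion carries the whole history because the strategy reads it. That a
    suitable ball exists for the choice operator is shown in \<open>inv\<close>.\<close>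
  define L where "L = rec_nat [(x0, 1)] (\<lambda>k hs. hs @ [SOME b. bob_legal P \<beta> (last hs) (\<sigma> hs) b \<and> good (Suc k) b])"
  define B where "B k = last (L k)" for k
  have L_Suc: "L (Suc k) = L k @ [B (Suc k)]"
    and B_Suc: "B (Suc k) = (SOME b. bob_legal P \<beta> (B k) (\<sigma> (L k)) b \<and> good (Suc k) b)" for k
    by (simp_all add: L_def B_def)
  have L0: "L 0 = [B 0]" and B0: "B 0 = (x0, 1)" by (simp_all add: L_def B_def)
  have L: "L k = map B [0..<Suc k]" for k
    by (induction k) (simp_all add: L0 L_Suc)
  have good_0: "good 0 (B 0)"
  proof -
    have "hit_weight P U a (B 0) \<le> (\<Sum>n. a n)"
      unfolding hit_weight_def by (rule suminf_le) auto
    with sum x0 show ?thesis by (simp add: good_def B0)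
  qed
  have inv: "bob_legal_upto P \<beta> \<sigma> B k \<and> good k (B k)" for k
  proof (induction k)
    case 0
    then show ?case using good_0 x0 by (simp add: bob_legal_upto_def B0)
  next
    case (Suc k)
    obtain x r where Bk: "B k = (x, r)" by fastforce
    obtain y \<epsilon> i where C: "\<sigma> (L k) = (y, \<epsilon>, i)" by (metis prod_cases3)
    have x: "x \<in> XP P" and r: "r = \<beta> ^ k" and W: "hit_weight P U a (x, r) < ennreal ((1 / real M) ^ k)"
      using Suc Bk by (auto simp: good_def)
    have r0: "r > 0" using r \<beta> by simp
    \<comment> \<open>A winning strategy never leaves Bob without an answer, and one legal answer is
      what the search for \<open>M\<close> separated ones starts from.\<close>
    have "alice_legal P \<beta> (B k) (\<sigma> (L k)) \<and> (\<exists>b. bob_legal P \<beta> (B k) (\<sigma> (L k)) b)"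
      using \<sigma> Suc unfolding alice_winning_strategy_def L by blast
    then obtain x' r' where al: "alice_legal P \<beta> (x, r) (y, \<epsilon>, i)"
        and bl: "bob_legal P \<beta> (x, r) (y, \<epsilon>, i) (x', r')"
      unfolding Bk C by auto
    obtain Z where Z: "separated_centers P (\<beta> * r) (ballX P x r - cyl P y \<epsilon> i) Z" "card Z = M"
      using bob_separated_choices[OF P \<beta> r0 x N al bl] .
    have "ennreal ((1 / real M) ^ k) \<le> a n" if "u \<in> U n" "v \<in> U n" "\<beta> * r \<le> dX P u v" for n u v
      using big[OF that(1,2), of k] that(3) r by simp
    moreover have "M > 0" using M by simp
    ultimately obtain z where z: "z \<in> Z" "hit_weight P U a (z, \<beta> * r) < ennreal ((1 / real M) ^ Suc k)"
      using light_child[OF Z _ W] by blast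
    have "bob_legal P \<beta> (x, r) (y, \<epsilon>, i) (z, \<beta> * r)"
      using separated_centersD(2,3)[OF Z(1) z(1)] \<beta> r0 by (simp add: bob_legal_def)
    moreover have "good (Suc k) (z, \<beta> * r)"
      using separated_centersD(2)[OF Z(1) z(1)] z(2) r by (simp add: good_def)
    ultimately have "\<exists>b. bob_legal P \<beta> (B k) (\<sigma> (L k)) b \<and> good (Suc k) b"
      unfolding Bk C by blast
    then have next_ball: "bob_legal P \<beta> (B k) (\<sigma> (L k)) (B (Suc k)) \<and> good (Suc k) (B (Suc k))"
      unfolding B_Suc by (rule someI_ex)
    then show ?case
      using Suc unfolding bob_legal_upto_def L by (auto simp: less_Suc_eq)
  qed
  then have "(\<Inter>n. ballX P (fst (B n)) (snd (B n))) \<inter> F \<noteq> {}"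
    using \<sigma> unfolding alice_winning_strategy_def by blast
  then obtain w where w: "\<And>k. w \<in> ballX P (fst (B k)) (snd (B k))" "w \<in> F" by blast
  then obtain n where n: "w \<in> U n" using cover by blast
  have lt: "a n < ennreal ((1 / real M) ^ k)" for k
    using hit_weight_ge[of w U n P "B k" a] n w(1)[of k] inv[of k] by (auto simp: good_def)
  have "a n < top" using lt[of 0] by (rule less_trans) simp
  then obtain e where e: "a n = ennreal e" "e > 0"
    using pos[of n] by (cases "a n") (auto simp: order_less_le)
  obtain k where "(1 / real M) ^ k < e"
    using real_arch_pow_inv[OF e(2), of "1 / real M"] M by auto
  then show False using lt[of k] e by (simp add: ennreal_less_iff)
qed

section \<open>From limits of logarithms to inequalities at one scale\<close>

text \<open>Right continuity puts \<open>f\<close> below 1 near 0, so both logarithms are negative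
  there. This makes the exponent \<open>s\<close> chosen later positive.\<close>

lemma dimension_function_Limsup_nonneg:
  assumes "dimension_function f"
  shows "0 \<le> Limsup (at_right 0) (\<lambda>\<delta>. ereal (ln (f \<delta>) / ln \<delta>))"
proof (rule le_Limsup)
  have f0: "f 0 = 0" and pos: "\<And>r. r > 0 \<Longrightarrow> f r > 0" and "continuous (at_right 0) f"
    using assms unfolding dimension_function_def by (auto simp: order_less_le)
  then have "(f \<longlongrightarrow> 0) (at_right 0)" by (simp add: continuous_within)
  then have "\<forall>\<^sub>F \<delta> in at_right 0. f \<delta> < 1" by (rule order_tendstoD) simp
  moreover have "\<forall>\<^sub>F \<delta> in at_right 0. \<delta> \<in> {0<..<1::real}"
    by (rule eventually_at_right_real) simp
  ultimately show "\<forall>\<^sub>F \<delta> in at_right 0. 0 \<le> ereal (ln (f \<delta>) / ln \<delta>)"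
  proof eventually_elim
    case (elim \<delta>)
    then have "ln (f \<delta>) \<le> 0" "ln \<delta> < 0" using pos[of \<delta>] by auto
    then show ?case by (simp add: divide_nonpos_neg)
  qed
qed simp

text \<open>For finite \<open>N\<close>, clearing the denominator and exponentiating gives
  \<open>\<beta> powr - s\<close> < \<open>N\<close>.\<close>

lemma NC_ge_of_exponent:
  assumes lt: "ereal s < ln_enat N / ereal \<bar>ln \<beta>\<bar>" and \<beta>: "0 < \<beta>" "\<beta> < 1"
    and K: "real K \<le> \<beta> powr - s"
  shows "enat K \<le> N"
proof (cases N)
  case (enat k)
  have ln: "\<bar>ln \<beta>\<bar> = - ln \<beta>" "- ln \<beta> > 0" using \<beta> by auto
  \<comment> \<open>\<open>ln_enat 0\<close> is minus infinity, which \<open>lt\<close>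
    excludes.\<close>
  have "k \<noteq> 0"
    using lt ln by (auto simp: enat ln_enat_def ereal_divide_eq zero_enat_def split: if_splits)
  then have "s < ln (real k) / (- ln \<beta>)"
    using lt ln by (simp add: enat ln_enat_def)
  then have "- s * ln \<beta> < ln (real k)"
    unfolding pos_less_divide_eq[OF ln(2)] by simp
  then have "\<beta> powr - s < real k"
    using \<beta> \<open>k \<noteq> 0\<close> by (simp add: powr_def ln_ge_iff flip: exp_less_cancel_iff[of _ "ln (real k)"])
  then show ?thesis using K enat by simp
qed simp

theorem proposition5p6:
  fixes P :: "nat set" and f :: "real \<Rightarrow> real" and F :: "xpoint set"
  assumes "\<forall>p\<in>P. prime p"
    and "dimension_function f"
    and "Limsup (at_right 0) (\<lambda>\<delta>. ereal (ln (f \<delta>) / ln \<delta>))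
           < Liminf (at_right 0) (\<lambda>\<beta>. ln_enat (NC P \<beta>) / ereal \<bar>ln \<beta>\<bar>)"
    and "CAW P F"
  shows "hausdorff_measure P f F > 0"
proof (rule ccontr)
  note P = assms(1)
  assume "\<not> hausdorff_measure P f F > 0"
  then have zero: "hausdorff_measure P f F = 0" by simp
  have fpos: "\<And>r. r > 0 \<Longrightarrow> f r > 0" and fnn: "\<And>r. r \<ge> 0 \<Longrightarrow> f r \<ge> 0"
    using assms(2) unfolding dimension_function_def by (auto simp: order_less_le)
  obtain s where s: "Limsup (at_right 0) (\<lambda>\<delta>. ereal (ln (f \<delta>) / ln \<delta>)) < ereal s"
      "ereal s < Liminf (at_right 0) (\<lambda>\<beta>. ln_enat (NC P \<beta>) / ereal \<bar>ln \<beta>\<bar>)"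
    using ereal_dense2[OF assms(3)] by blast
  \<comment> \<open>The gap between \<open>s\<close> and \<open>s'\<close> pays for the factor 2 and
    for rounding \<open>T\<close> up to \<open>M\<close>.\<close>
  obtain s' where s': "ereal s < ereal s'"
      "ereal s' < Liminf (at_right 0) (\<lambda>\<beta>. ln_enat (NC P \<beta>) / ereal \<bar>ln \<beta>\<bar>)"
    using ereal_dense2[OF s(2)] by blast
  have "0 < ereal s" using dimension_function_Limsup_nonneg[OF assms(2)] s(1) by (rule le_less_trans)
  then have s0: "s > 0" and ss': "s < s'" using s' by simp_all

  obtain \<delta>0 where \<delta>0: "\<delta>0 > 0" "\<And>\<delta>. 0 < \<delta> \<Longrightarrow> \<delta> < \<delta>0 \<Longrightarrow> ln (f \<delta>) / ln \<delta> < s"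
    using Limsup_lessD[OF s(1)] unfolding eventually_at_right_field by auto
  have f_ge: "\<delta> powr s \<le> f \<delta>" if "0 < \<delta>" "\<delta> < \<delta>0" "\<delta> < 1" for \<delta>
  proof -
    have "s * ln \<delta> < ln (f \<delta>)"
      using \<delta>0(2)[OF that(1,2)] that by (simp add: neg_divide_less_eq)
    then have "exp (s * ln \<delta>) < exp (ln (f \<delta>))" by simp
    then show ?thesis using that fpos[of \<delta>] by (simp add: powr_def)
  qed

  obtain \<beta>0 where \<beta>0: "\<beta>0 > 0"
      "\<And>\<beta>. 0 < \<beta> \<Longrightarrow> \<beta> < \<beta>0 \<Longrightarrow> ereal s' < ln_enat (NC P \<beta>) / ereal \<bar>ln \<beta>\<bar>"
    using less_LiminfD[OF s'(2)] unfolding eventually_at_right_field by auto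
  obtain \<beta>1 where \<beta>1: "\<beta>1 > 0" "\<And>\<beta>. 0 < \<beta> \<Longrightarrow> \<beta> < \<beta>1 \<Longrightarrow> cylinder_absolute_winning_for P \<beta> F"
    using assms(4) unfolding CAW_def by auto
  \<comment> \<open>Since \<open>s - s'\<close> is negative, the power
    \<open>\<beta> powr (s - s')\<close> is at least 6 for \<open>\<beta>\<close> below
    \<open>c\<close>. The 6 comes from \<open>2 * M\<close> \<le> \<open>2 * (T + 2)\<close> \<le>
    \<open>6 * T\<close>.\<close>
  define c :: real where "c = 6 powr (1 / (s - s'))"
  have "min (min \<beta>0 \<beta>1) (min c 1) > 0" using \<beta>0(1) \<beta>1(1) by (simp add: c_def)
  then obtain \<beta> where \<beta>: "0 < \<beta>" "\<beta> < \<beta>0" "\<beta> < \<beta>1" "\<beta> < c" "\<beta> < 1"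
    using dense[of 0 "min (min \<beta>0 \<beta>1) (min c 1)"] by auto
  obtain \<sigma> where \<sigma>: "alice_winning_strategy P \<beta> F \<sigma>"
    using \<beta>1(2)[OF \<beta>(1,3)] unfolding cylinder_absolute_winning_for_def by blast

  define T where "T = \<beta> powr - s"
  have T1: "T \<ge> 1" using \<beta> s0 powr_mono2'[of "- s" \<beta> 1] by (simp add: T_def)
  \<comment> \<open>Rounding up gives \<open>T\<close> \<le> \<open>M\<close>, and the extra 1 gives
    \<open>M\<close> \<ge> 2 from \<open>T\<close> \<ge> 1.\<close>
  define M where "M = nat \<lceil>T\<rceil> + 1"
  have M2: "M \<ge> 2" and MT: "T \<le> real M" and M3: "real M \<le> T + 2"
    using T1 unfolding M_def by linarith+
  have "6 = c powr (s - s')" using ss' by (simp add: c_def powr_powr)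
  also have "\<dots> \<le> \<beta> powr (s - s')"
    using \<beta> ss' by (intro powr_mono2') auto
  finally have "6 * T \<le> \<beta> powr (s - s') * T" using T1 by (intro mult_right_mono) auto
  also have "\<dots> = \<beta> powr - s'" by (simp add: T_def flip: powr_add)
  finally have "real (2 * M) \<le> \<beta> powr - s'" using M3 T1 by simp
  then have N: "enat (2 * M) \<le> NC P \<beta>"
    using \<beta>0(2)[OF \<beta>(1,2)] \<beta> by (intro NC_ge_of_exponent[of s'])

  define \<delta> where "\<delta> = min \<delta>0 1 / 2"
  have \<delta>: "\<delta> > 0" "\<delta> < \<delta>0" "\<delta> < 1" using \<delta>0(1) by (auto simp: \<delta>_def)
  have "hausdorff_premeasure P f \<delta> F \<le> hausdorff_measure P f F"
    unfolding hausdorff_measure_eq_SUP using \<delta> by (intro SUP_upper) simp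
  \<comment> \<open>Scaling by \<open>T\<close> turns this bound into 1/4; with the padding of total
    1/2 the weights stay below 1.\<close>
  then have "hausdorff_premeasure P f \<delta> F < ennreal (1 / (4 * T))"
    using zero T1 by simp
  then obtain U where U: "F \<subseteq> (\<Union>n. U n)" "\<And>n. diamX P (U n) \<le> ennreal \<delta>"
      and sum: "(\<Sum>n. ennreal (f (enn2real (diamX P (U n))))) < ennreal (1 / (4 * T))"
    unfolding hausdorff_premeasure_def Inf_less_iff by blast
  let ?g = "\<lambda>n. enn2real (diamX P (U n))"
  \<comment> \<open>The geometric padding makes every weight positive, also where the gauge
    vanishes.\<close>
  let ?a = "\<lambda>n. ennreal T * ennreal (f (?g n)) + ennreal ((1/2) ^ Suc n / 2)"
  have "(\<Sum>n. ?a n) < 1"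
  proof -
    have half: "(\<lambda>n. (1/2) ^ Suc n / 2) sums (1 / 2 :: real)"
      by (rule sums_divide[OF power_half_series])
    have "(\<Sum>n. ?a n) = ennreal T * (\<Sum>n. ennreal (f (?g n))) + (\<Sum>n. ennreal ((1/2) ^ Suc n / 2))"
      by (simp add: suminf_add ennreal_suminf_cmult flip: suminf_add)
    also have "(\<Sum>n. ennreal ((1/2) ^ Suc n / 2)) = ennreal (1/2)"
      using half by (intro suminf_ennreal_eq) auto
    also have "ennreal T * (\<Sum>n. ennreal (f (?g n))) \<le> ennreal T * ennreal (1 / (4 * T))"
      using sum by (intro mult_left_mono) auto
    also have "\<dots> = ennreal (1 / 4)" using T1 by (simp flip: ennreal_mult)
    also have "ennreal (1 / 4) + ennreal (1 / 2) = ennreal (3 / 4)"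
      by (subst ennreal_plus[symmetric]) auto
    also have "\<dots> < 1" by (simp add: ennreal_less_one_iff)
    finally show ?thesis by (simp add: add_right_mono)
  qed
  \<comment> \<open>The gauge of such a set is at least \<open>(1 / T) ^ Suc k\<close>; the factor
    \<open>T\<close> in the weight restores the exponent \<open>k\<close>.\<close>
  moreover have "ennreal ((1 / real M) ^ k) \<le> ?a n"
    if uv: "u \<in> U n" "v \<in> U n" and d: "\<beta> ^ Suc k \<le> dX P u v" for n k u v
  proof -
    have "ennreal (dX P u v) \<le> diamX P (U n)"
      unfolding diamX_def using uv by (intro SUP_upper2[of "(u, v)"]) auto
    \<comment> \<open>\<open>enn2real\<close> sends infinity to 0, a case excluded by the bound
      \<open>\<delta>\<close> on the diameter.\<close>
    also have "\<dots> = ennreal (?g n)"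
      using U(2)[of n] le_less_trans[OF _ ennreal_less_top] by simp
    finally have "dX P u v \<le> ?g n" by (simp add: ennreal_le_iff)
    with d have g: "\<beta> ^ Suc k \<le> ?g n" by linarith
    have "0 < \<beta> ^ Suc k" using \<beta> by simp
    with g have g0: "0 < ?g n" by linarith
    have "?g n \<le> \<delta>" using U(2)[of n] \<delta>(1) by (simp add: enn2real_leI)
    then have "?g n powr s \<le> f (?g n)" using f_ge[OF g0] \<delta> by linarith
    moreover have "(\<beta> ^ Suc k) powr s \<le> ?g n powr s"
      using g \<beta> s0 by (intro powr_mono2) auto
    moreover have "(\<beta> ^ Suc k) powr s = (1 / T) ^ Suc k"
    proof -
      have "(\<beta> ^ Suc k) powr s = (\<beta> powr s) powr real (Suc k)"
        using \<beta> by (simp add: powr_powr mult.commute flip: powr_realpow del: power_Suc)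
      also have "\<dots> = (1 / T) ^ Suc k"
        using \<beta> by (subst powr_realpow) (simp_all add: T_def powr_minus divide_inverse)
      finally show ?thesis .
    qed
    ultimately have "(1 / T) ^ Suc k \<le> f (?g n)" by linarith
    then have "T * (1 / T) ^ Suc k \<le> T * f (?g n)" using T1 by (intro mult_left_mono) auto
    then have "(1 / T) ^ k \<le> T * f (?g n)" using T1 by simp
    moreover have "(1 / real M) ^ k \<le> (1 / T) ^ k"
      using MT T1 by (intro power_mono divide_left_mono) auto
    ultimately have "ennreal ((1 / real M) ^ k) \<le> ennreal (T * f (?g n))" by (intro ennreal_leI) linarith
    also have "\<dots> = ennreal T * ennreal (f (?g n))"
      using T1 fnn by (intro ennreal_mult) auto
    also have "\<dots> \<le> ?a n" by simp
    finally show ?thesis .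
  qed
  moreover have "0 < ?a n" for n by (rule add_nonneg_pos) simp_all
  ultimately show False
    using winning_set_not_covered[OF P \<sigma> \<beta>(1) N M2 U(1), of ?a] by blast
qed

end
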